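(* Let $\mathcal P=\langle X\mid R\rangle$ be a finitely generated group presentation ($X$ finite, no hypothesis on the cardinality or decidability of $R$), and let $\Gamma$ be the associated function defined in the context. Then $\mathcal P$ has a solvable Conjugacy Problem if and only if it has a solvable Word Problem and $\Gamma$ is bounded above by a computable function. In this case $\Gamma$ is computable.
   Context: Let $\mathcal G$ be the group presented by $\mathcal P$, and let $\mathcal F(X)$ be the free group on $X$ (reduced words). A reduced word is cyclically reduced if its last letter is not the inverse of its first. For cyclically reduced words $w_1,w_2$ conjugate in $\mathcal G$, put $\gamma(w_1,w_2)=\min\{|t|:t\in\mathcal F(X),\ w_1=tw_2t^{-1}\text{ in }\mathcal G\}$. For natural numbers $n_1,n_2$ put $\Gamma(n_1,n_2)=\max\{\gamma(w_1,w_2): w_1,w_2\text{ cyclically reduced, conjugate in }\mathcal G,\ |w_1|\leqslant n_1,\ |w_2|\leqslant n_2\}$. The Word Problem is solvable if there is an algorithm deciding whether an element of $\mathcal F(X)$ is trivial in $\mathcal G$. The Conjugacy Problem is solvable if there is an algorithm deciding, given $u,v\in\mathcal F(X)$, whether $u$ and $v$ are conjugate in $\mathcal G$. *)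

theory Defs
  imports "HOL-Algebra.Coset" "HOL-Algebra.Generated_Groups"
    "HOL-Library.Countable_Set" "HOL-Library.Nat_Bijection"
begin

section \<open>Free groups as groups of reduced words\<close>

text \<open>A letter \<open>(x, True)\<close> stands for the generator \<open>x\<close>, and \<open>(x, False)\<close> for its formal inverse.\<close>

type_synonym 'a letter = "'a \<times> bool"
type_synonym 'a gword = "'a letter list"

definition inv_letter :: "'a letter \<Rightarrow> 'a letter" where
  "inv_letter a = (fst a, \<not> snd a)"

definition reduced :: "'a gword \<Rightarrow> bool" where
  "reduced w \<longleftrightarrow> (\<forall>i. Suc i < length w \<longrightarrow> w ! Suc i \<noteq> inv_letter (w ! i))"

definition cyclically_reduced :: "'a gword \<Rightarrow> bool" where
  "cyclically_reduced w \<longleftrightarrow> reduced w \<and> (w \<noteq> [] \<longrightarrow> last w \<noteq> inv_letter (hd w))"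

fun cons_cancel :: "'a letter \<Rightarrow> 'a gword \<Rightarrow> 'a gword" where
  "cons_cancel a [] = [a]"
| "cons_cancel a (b # w) = (if b = inv_letter a then w else a # b # w)"

definition reduce :: "'a gword \<Rightarrow> 'a gword" where
  "reduce w = foldr cons_cancel w []"

definition free_group :: "'a set \<Rightarrow> 'a gword monoid" where
  "free_group X =
     \<lparr> carrier = {w. set w \<subseteq> X \<times> UNIV \<and> reduced w},
       monoid.mult = (\<lambda>u v. reduce (u @ v)),
       one = [] \<rparr>"


section \<open>Groups given by presentations\<close>

definition normal_closure :: "('g, 'm) monoid_scheme \<Rightarrow> 'g set \<Rightarrow> 'g set" where
  "normal_closure G S =
     generate G {g \<otimes>\<^bsub>G\<^esub> r \<otimes>\<^bsub>G\<^esub> inv\<^bsub>G\<^esub> g | g r. g \<in> carrier G \<and> r \<in> S}"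

definition presented_group :: "'a set \<Rightarrow> 'a gword set \<Rightarrow> 'a gword set monoid" where
  "presented_group X R = free_group X Mod normal_closure (free_group X) R"

definition word_class :: "'a set \<Rightarrow> 'a gword set \<Rightarrow> 'a gword \<Rightarrow> 'a gword set" where
  "word_class X R w = normal_closure (free_group X) R #>\<^bsub>free_group X\<^esub> w"

definition trivial_in :: "'a set \<Rightarrow> 'a gword set \<Rightarrow> 'a gword \<Rightarrow> bool" where
  "trivial_in X R w \<longleftrightarrow> word_class X R w = \<one>\<^bsub>presented_group X R\<^esub>"

definition conjugates_by :: "'a set \<Rightarrow> 'a gword set \<Rightarrow> 'a gword \<Rightarrow> 'a gword \<Rightarrow> 'a gword \<Rightarrow> bool" where
  "conjugates_by X R t w\<^sub>1 w\<^sub>2 \<longleftrightarrow>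
     word_class X R w\<^sub>1 =
       word_class X R t \<otimes>\<^bsub>presented_group X R\<^esub> word_class X R w\<^sub>2
         \<otimes>\<^bsub>presented_group X R\<^esub> inv\<^bsub>presented_group X R\<^esub> word_class X R t"

definition conjugate_in :: "'a set \<Rightarrow> 'a gword set \<Rightarrow> 'a gword \<Rightarrow> 'a gword \<Rightarrow> bool" where
  "conjugate_in X R u v \<longleftrightarrow>
     (\<exists>g \<in> carrier (presented_group X R).
        word_class X R u =
          g \<otimes>\<^bsub>presented_group X R\<^esub> word_class X R v
            \<otimes>\<^bsub>presented_group X R\<^esub> inv\<^bsub>presented_group X R\<^esub> g)"

text \<open>\<open>conj_length\<close> is \<open>\<gamma>\<close>; it is meaningful only for words that are conjugate in the
  presented group. \<open>conj_length_bound\<close> is \<open>\<Gamma>\<close>; for finite \<open>X\<close> the maximum ranges over a finite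
  nonempty set.\<close>

definition conj_length :: "'a set \<Rightarrow> 'a gword set \<Rightarrow> 'a gword \<Rightarrow> 'a gword \<Rightarrow> nat" where
  "conj_length X R w\<^sub>1 w\<^sub>2 =
     (LEAST n. \<exists>t \<in> carrier (free_group X). length t = n \<and> conjugates_by X R t w\<^sub>1 w\<^sub>2)"

definition conj_length_bound :: "'a set \<Rightarrow> 'a gword set \<Rightarrow> nat \<Rightarrow> nat \<Rightarrow> nat" where
  "conj_length_bound X R n\<^sub>1 n\<^sub>2 =
     Max {conj_length X R w\<^sub>1 w\<^sub>2 | w\<^sub>1 w\<^sub>2.
            w\<^sub>1 \<in> carrier (free_group X) \<and> w\<^sub>2 \<in> carrier (free_group X) \<and>
            cyclically_reduced w\<^sub>1 \<and> cyclically_reduced w\<^sub>2 \<and>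
            conjugate_in X R w\<^sub>1 w\<^sub>2 \<and> length w\<^sub>1 \<le> n\<^sub>1 \<and> length w\<^sub>2 \<le> n\<^sub>2}"


section \<open>Partial recursive functions\<close>

datatype recf =
    Zero
  | Succ
  | Proj nat
  | Comp recf "recf list"
  | PrimRec recf recf
  | Mu recf

text \<open>\<open>rec_eval f xs y\<close>: the partial recursive function described by \<open>f\<close> is defined at the argument
  tuple \<open>xs\<close>, with value \<open>y\<close>. In \<open>PrimRec\<close> the recursion argument comes first, and the step function
  receives the recursion argument, the previous value and the parameters, in this order.\<close>

inductive rec_eval :: "recf \<Rightarrow> nat list \<Rightarrow> nat \<Rightarrow> bool" where
  Zero: "rec_eval Zero xs 0"
| Succ: "rec_eval Succ [x] (Suc x)"
| Proj: "i < length xs \<Longrightarrow> rec_eval (Proj i) xs (xs ! i)"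
| Comp: "list_all2 (\<lambda>g y. rec_eval g xs y) gs ys \<Longrightarrow> rec_eval f ys z \<Longrightarrow> rec_eval (Comp f gs) xs z"
| PrimRec_0: "rec_eval f xs y \<Longrightarrow> rec_eval (PrimRec f g) (0 # xs) y"
| PrimRec_Suc: "rec_eval (PrimRec f g) (n # xs) y \<Longrightarrow> rec_eval g (n # y # xs) z \<Longrightarrow>
    rec_eval (PrimRec f g) (Suc n # xs) z"
| Mu: "rec_eval f (n # xs) 0 \<Longrightarrow> \<forall>m<n. \<exists>y. rec_eval f (m # xs) (Suc y) \<Longrightarrow> rec_eval (Mu f) xs n"

definition computable2 :: "(nat \<Rightarrow> nat \<Rightarrow> nat) \<Rightarrow> bool" where
  "computable2 f \<longleftrightarrow> (\<exists>r. \<forall>m n. rec_eval r [m, n] (f m n))"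


section \<open>The word problem and the conjugacy problem\<close>

text \<open>Words are presented to an algorithm through a Goedel numbering based on the fixed enumeration
  \<open>to_nat_on X\<close> of the finite set \<open>X\<close>; any other enumeration of \<open>X\<close> differs from it by a finite
  permutation, so the choice has no influence on decidability. An algorithm has to halt with the
  correct answer on (codes of) elements of the free group only.\<close>

definition letter_code :: "'a set \<Rightarrow> 'a letter \<Rightarrow> nat" where
  "letter_code X a = 2 * to_nat_on X (fst a) + of_bool (snd a)"

definition word_code :: "'a set \<Rightarrow> 'a gword \<Rightarrow> nat" where
  "word_code X w = list_encode (map (letter_code X) w)"

definition solvable_word_problem :: "'a set \<Rightarrow> 'a gword set \<Rightarrow> bool" where
  "solvable_word_problem X R \<longleftrightarrow>
     (\<exists>r. \<forall>u \<in> carrier (free_group X).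
        rec_eval r [word_code X u] (if trivial_in X R u then 1 else 0))"

definition solvable_conjugacy_problem :: "'a set \<Rightarrow> 'a gword set \<Rightarrow> bool" where
  "solvable_conjugacy_problem X R \<longleftrightarrow>
     (\<exists>r. \<forall>u \<in> carrier (free_group X). \<forall>v \<in> carrier (free_group X).
        rec_eval r [word_code X u, word_code X v] (if conjugate_in X R u v then 1 else 0))"


section \<open>Well-definedness\<close>

lemma rec_eval_functional: "rec_eval f xs y \<Longrightarrow> rec_eval f xs z \<Longrightarrow> y = z"
proof (induction arbitrary: z rule: rec_eval.induct)
  case (Comp xs gs ys f z z')
  from Comp.prems obtain ys' where ys': "list_all2 (\<lambda>g y. rec_eval g xs y) gs ys'" "rec_eval f ys' z'"
    by cases
  have "ys = ys'"
    using Comp.IH(1) ys'(1) by (auto simp: list_all2_conv_all_nth intro!: nth_equalityI)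
  with ys' Comp.IH show ?case by blast
next
  case (PrimRec_Suc f g n xs y z)
  from PrimRec_Suc.prems show ?case
    by cases (use PrimRec_Suc.IH in blast)
next
  case (Mu f n xs)
  from Mu.prems have z: "rec_eval f (z # xs) 0" "\<forall>m<z. \<exists>y. rec_eval f (m # xs) (Suc y)"
    by (cases; auto)+
  show ?case
  proof (cases n z rule: linorder_cases)
    case less
    with z(2) Mu.IH(1) show ?thesis by (metis nat.distinct(1))
  next
    case greater
    with z(1) Mu.IH(2) show ?thesis by (metis nat.distinct(1))
  qed
next
  case (Zero xs)
  then show ?case by cases simp
next
  case (Succ x)
  then show ?case by cases simp
next
  case (Proj i xs)
  from Proj.prems show ?case by cases simp
next
  case (PrimRec_0 f xs y g)
  from PrimRec_0.prems show ?case
    by cases (use PrimRec_0.IH in blast)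
qed

lemma inv_letter_inv_letter [simp]: "inv_letter (inv_letter a) = a"
  by (simp add: inv_letter_def)

lemma inv_letter_neq [simp]: "inv_letter a \<noteq> a" "a \<noteq> inv_letter a"
  by (cases a; simp add: inv_letter_def)+

lemma inv_letter_eq_iff [simp]: "inv_letter a = inv_letter b \<longleftrightarrow> a = b"
  by (metis inv_letter_inv_letter)

lemma fst_inv_letter [simp]: "fst (inv_letter a) = fst a"
  by (simp add: inv_letter_def)

lemma reduced_Nil [simp]: "reduced []"
  by (simp add: reduced_def)

lemma reduced_single [simp]: "reduced [a]"
  by (simp add: reduced_def)

lemma reduced_Cons_Cons [simp]: "reduced (a # b # w) \<longleftrightarrow> b \<noteq> inv_letter a \<and> reduced (b # w)"
  unfolding reduced_def by (auto simp: nth_Cons split: nat.splits)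

lemma reduced_ConsD: "reduced (a # w) \<Longrightarrow> reduced w"
  by (cases w) auto

lemma reduced_cons_cancel: "reduced w \<Longrightarrow> reduced (cons_cancel a w)"
  by (cases w) (auto dest: reduced_ConsD)

lemma reduced_foldr: "reduced v \<Longrightarrow> reduced (foldr cons_cancel u v)"
  by (induction u) (auto intro: reduced_cons_cancel)

lemma reduced_reduce: "reduced (reduce w)"
  by (simp add: reduce_def reduced_foldr)

lemma cons_cancel_inverse: "reduced w \<Longrightarrow> cons_cancel (inv_letter a) (cons_cancel a w) = w"
proof (cases w)
  case (Cons b v)
  then show "reduced w \<Longrightarrow> ?thesis" by (cases v) auto
qed simp

lemma reduce_reduced: "reduced w \<Longrightarrow> reduce w = w"
proof (induction w)
  case (Cons a w)
  then show ?case by (cases w) (auto simp: reduce_def)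
qed (simp add: reduce_def)

lemma foldr_cons_cancel:
  assumes "reduced u" "reduced v"
  shows "foldr cons_cancel (cons_cancel a u) v = cons_cancel a (foldr cons_cancel u v)"
proof (cases u)
  case (Cons b w)
  show ?thesis
  proof (cases "b = inv_letter a")
    case True
    with Cons assms cons_cancel_inverse[of "foldr cons_cancel w v" "inv_letter a"] show ?thesis
      by (simp add: reduced_foldr)
  qed (use Cons in simp)
qed simp

lemma foldr_reduce: "reduced v \<Longrightarrow> foldr cons_cancel (reduce u) v = foldr cons_cancel u v"
proof (induction u)
  case (Cons a u)
  then show ?case
    using foldr_cons_cancel[OF reduced_reduce[of u] Cons.prems, of a] by (simp add: reduce_def)
qed (simp add: reduce_def)

lemma reduce_append: "reduce (u @ v) = foldr cons_cancel u (reduce v)"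
  by (simp add: reduce_def)

lemma reduce_append_left: "reduce (reduce u @ v) = reduce (u @ v)"
  by (simp add: reduce_append foldr_reduce reduced_reduce)

lemma reduce_append_right: "reduce (u @ reduce v) = reduce (u @ v)"
  by (simp add: reduce_append reduce_reduced reduced_reduce)

lemma set_cons_cancel: "set (cons_cancel a w) \<subseteq> insert a (set w)"
  by (cases w) auto

lemma set_reduce: "set (reduce w) \<subseteq> set w"
proof (induction w)
  case (Cons a w)
  then show ?case using set_cons_cancel[of a "reduce w"] by (auto simp: reduce_def)
qed (simp add: reduce_def)

definition inv_word :: "'a gword \<Rightarrow> 'a gword" where
  "inv_word w = rev (map inv_letter w)"

lemma reduce_inv_word: "reduce (inv_word w @ w) = []"
proof (induction w)
  case (Cons a w)
  have "reduce (inv_word (a # w) @ a # w) = reduce (inv_word w @ [inv_letter a] @ a # w)"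
    by (simp add: inv_word_def)
  also have "\<dots> = reduce (inv_word w @ reduce ([inv_letter a] @ a # w))"
    by (simp only: reduce_append_right)
  also have "reduce ([inv_letter a] @ a # w) = reduce w"
    using cons_cancel_inverse[OF reduced_reduce, of a w] by (simp add: reduce_def)
  finally show ?case
    using Cons by (simp add: reduce_append_right)
qed (simp add: inv_word_def reduce_def)

lemma inv_word_carrier:
  assumes "w \<in> carrier (free_group X)"
  shows "reduce (inv_word w) \<in> carrier (free_group X)"
proof -
  have "set (inv_word w) \<subseteq> X \<times> UNIV"
    using assms by (auto simp: free_group_def inv_word_def inv_letter_def)
  with set_reduce[of "inv_word w"] show ?thesis
    by (simp add: free_group_def reduced_reduce subset_trans)
qed

lemma group_free_group: "group (free_group X)"
proof (rule groupI)
  fix u v assume "u \<in> carrier (free_group X)" "v \<in> carrier (free_group X)"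
  then show "u \<otimes>\<^bsub>free_group X\<^esub> v \<in> carrier (free_group X)"
    using set_reduce[of "u @ v"] by (auto simp: free_group_def reduced_reduce)
next
  fix w assume w: "w \<in> carrier (free_group X)"
  show "\<exists>v \<in> carrier (free_group X). v \<otimes>\<^bsub>free_group X\<^esub> w = \<one>\<^bsub>free_group X\<^esub>"
    using inv_word_carrier[OF w]
    by (intro bexI[of _ "reduce (inv_word w)"])
       (auto simp: free_group_def reduce_append_left reduce_inv_word)
qed (auto simp: free_group_def reduce_append_left reduce_append_right reduce_reduced)

lemma normal_normal_closure:
  assumes "group G" "S \<subseteq> carrier G"
  shows "normal_closure G S \<lhd> G"
proof -
  interpret group G by fact
  show ?thesis
    unfolding normal_closure_def
  proof (rule normal_generateI)
    show "{g \<otimes>\<^bsub>G\<^esub> r \<otimes>\<^bsub>G\<^esub> inv\<^bsub>G\<^esub> g |g r. g \<in> carrier G \<and> r \<in> S} \<subseteq> carrier G"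
      using assms by auto
  next
    fix h g assume "h \<in> {g \<otimes>\<^bsub>G\<^esub> r \<otimes>\<^bsub>G\<^esub> inv\<^bsub>G\<^esub> g |g r. g \<in> carrier G \<and> r \<in> S}" and g: "g \<in> carrier G"
    then obtain k r where kr: "k \<in> carrier G" "r \<in> S" "h = k \<otimes>\<^bsub>G\<^esub> r \<otimes>\<^bsub>G\<^esub> inv\<^bsub>G\<^esub> k"
      by auto
    then have "g \<otimes>\<^bsub>G\<^esub> h \<otimes>\<^bsub>G\<^esub> inv\<^bsub>G\<^esub> g = (g \<otimes>\<^bsub>G\<^esub> k) \<otimes>\<^bsub>G\<^esub> r \<otimes>\<^bsub>G\<^esub> inv\<^bsub>G\<^esub> (g \<otimes>\<^bsub>G\<^esub> k)"
      using g assms(2) by (auto simp: inv_mult_group m_assoc subset_iff)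
    with kr g show "g \<otimes>\<^bsub>G\<^esub> h \<otimes>\<^bsub>G\<^esub> inv\<^bsub>G\<^esub> g \<in> {g \<otimes>\<^bsub>G\<^esub> r \<otimes>\<^bsub>G\<^esub> inv\<^bsub>G\<^esub> g |g r. g \<in> carrier G \<and> r \<in> S}"
      by (intro CollectI exI[of _ "g \<otimes>\<^bsub>G\<^esub> k"] exI[of _ r]) auto
  qed
qed

lemma group_presented_group:
  assumes "R \<subseteq> carrier (free_group X)"
  shows "group (presented_group X R)"
  unfolding presented_group_def
  by (rule normal.factorgroup_is_group[OF normal_normal_closure[OF group_free_group assms]])

lemma carrier_presented_group:
  "carrier (presented_group X R) = word_class X R ` carrier (free_group X)"
  by (auto simp: presented_group_def FactGroup_def RCOSETS_def word_class_def)

lemma word_class_hom: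
  assumes "R \<subseteq> carrier (free_group X)"
  shows "word_class X R \<in> hom (free_group X) (presented_group X R)"
  unfolding presented_group_def word_class_def
  by (rule normal.r_coset_hom_Mod[OF normal_normal_closure[OF group_free_group assms]])

lemma conjugate_in_iff:
  "conjugate_in X R u v \<longleftrightarrow> (\<exists>t \<in> carrier (free_group X). conjugates_by X R t u v)"
  by (simp add: conjugate_in_def conjugates_by_def carrier_presented_group)

lemma finite_conj_lengths:
  assumes "finite X"
  shows "finite {conj_length X R w\<^sub>1 w\<^sub>2 | w\<^sub>1 w\<^sub>2.
            w\<^sub>1 \<in> carrier (free_group X) \<and> w\<^sub>2 \<in> carrier (free_group X) \<and>
            cyclically_reduced w\<^sub>1 \<and> cyclically_reduced w\<^sub>2 \<and>
            conjugate_in X R w\<^sub>1 w\<^sub>2 \<and> length w\<^sub>1 \<le> n\<^sub>1 \<and> length w\<^sub>2 \<le> n\<^sub>2}"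
proof (rule finite_subset)
  let ?W = "\<lambda>n. {w. set w \<subseteq> X \<times> (UNIV :: bool set) \<and> length w \<le> n}"
  show "{conj_length X R w\<^sub>1 w\<^sub>2 | w\<^sub>1 w\<^sub>2.
            w\<^sub>1 \<in> carrier (free_group X) \<and> w\<^sub>2 \<in> carrier (free_group X) \<and>
            cyclically_reduced w\<^sub>1 \<and> cyclically_reduced w\<^sub>2 \<and>
            conjugate_in X R w\<^sub>1 w\<^sub>2 \<and> length w\<^sub>1 \<le> n\<^sub>1 \<and> length w\<^sub>2 \<le> n\<^sub>2}
        \<subseteq> (\<lambda>(u, v). conj_length X R u v) ` (?W n\<^sub>1 \<times> ?W n\<^sub>2)"
    by (auto simp: free_group_def)
  show "finite ((\<lambda>(u, v). conj_length X R u v) ` (?W n\<^sub>1 \<times> ?W n\<^sub>2))"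
    using assms by (intro finite_imageI finite_cartesian_product finite_lists_length_le) auto
qed

lemma conj_lengths_nonempty:
  "{conj_length X R w\<^sub>1 w\<^sub>2 | w\<^sub>1 w\<^sub>2.
      w\<^sub>1 \<in> carrier (free_group X) \<and> w\<^sub>2 \<in> carrier (free_group X) \<and>
      cyclically_reduced w\<^sub>1 \<and> cyclically_reduced w\<^sub>2 \<and>
      conjugate_in X R w\<^sub>1 w\<^sub>2 \<and> length w\<^sub>1 \<le> n\<^sub>1 \<and> length w\<^sub>2 \<le> n\<^sub>2} \<noteq> {}"
  if R: "R \<subseteq> carrier (free_group X)"
proof -
  interpret G: group "presented_group X R" by (rule group_presented_group[OF R])
  have e: "[] \<in> carrier (free_group X)" "cyclically_reduced []"
    by (simp_all add: free_group_def cyclically_reduced_def)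
  then have "word_class X R [] \<in> carrier (presented_group X R)"
    by (simp add: carrier_presented_group)
  then have "conjugate_in X R [] []"
    unfolding conjugate_in_def by (intro bexI[of _ "\<one>\<^bsub>presented_group X R\<^esub>"]) auto
  with e have "conj_length X R [] [] \<in> {conj_length X R w\<^sub>1 w\<^sub>2 | w\<^sub>1 w\<^sub>2.
      w\<^sub>1 \<in> carrier (free_group X) \<and> w\<^sub>2 \<in> carrier (free_group X) \<and>
      cyclically_reduced w\<^sub>1 \<and> cyclically_reduced w\<^sub>2 \<and>
      conjugate_in X R w\<^sub>1 w\<^sub>2 \<and> length w\<^sub>1 \<le> n\<^sub>1 \<and> length w\<^sub>2 \<le> n\<^sub>2}"
    by (intro CollectI exI[of _ "[]"]) simp
  then show ?thesis by blast
qed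

lemma inj_on_word_code:
  assumes "finite X"
  shows "inj_on (word_code X) (carrier (free_group X))"
proof -
  have "inj_on (letter_code X) (X \<times> UNIV)"
  proof (rule inj_onI)
    fix a b assume ab: "a \<in> X \<times> (UNIV :: bool set)" "b \<in> X \<times> UNIV" "letter_code X a = letter_code X b"
    from ab(3) have "to_nat_on X (fst a) = to_nat_on X (fst b) \<and> snd a = snd b"
      unfolding letter_code_def by (cases "snd a"; cases "snd b"; simp; presburger)
    with ab assms show "a = b"
      by (auto simp: countable_finite to_nat_on_inj)
  qed
  then show ?thesis
    by (intro inj_onI)
       (auto simp: word_code_def free_group_def list_encode_eq intro: map_inj_on inj_on_subset)
qed

end

theory Submission
  imports Defs
begin

text \<open>If the word problem is solvable and \<open>f\<close> bounds \<open>\<Gamma>\<close>, then words \<open>u\<close> and \<open>v\<close> are conjugate iff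
  they are conjugate by a word of length at most \<open>|u| + f |u| |v| + |v|\<close>: conjugating \<open>u\<close> and \<open>v\<close> to
  cyclically reduced words costs at most \<open>|u|\<close> and \<open>|v|\<close>, and \<open>\<Gamma>\<close> is monotone. This is a finite search
  that needs no cyclic reduction. Conversely, a word is trivial iff it is conjugate to the empty
  word, and \<open>\<Gamma> n\<^sub>1 n\<^sub>2\<close> is the least \<open>n\<close> such that all conjugate cyclically reduced words of length at
  most \<open>n\<^sub>1\<close> and \<open>n\<^sub>2\<close> are conjugate by a word of length at most \<open>n\<close>. The condition on \<open>n\<close> is
  decidable, so \<open>\<Gamma>\<close> is computed by unbounded minimisation.\<close>

section \<open>Closure properties of computable functions\<close>

text \<open>A function of several variables is a functional of an environment \<open>e\<close> that assigns the
  value \<open>e i\<close> to the \<open>i\<close>-th variable. A program may be run on any sufficiently long initial segment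
  of the environment, so that arities need not be tracked.\<close>

definition computable :: "((nat \<Rightarrow> nat) \<Rightarrow> nat) \<Rightarrow> bool" where
  "computable F \<longleftrightarrow> (\<exists>r n. \<forall>e. \<forall>m\<ge>n. rec_eval r (map e [0..<m]) (F e))"

abbreviation decidable :: "((nat \<Rightarrow> nat) \<Rightarrow> bool) \<Rightarrow> bool" where
  "decidable P \<equiv> computable (\<lambda>e. of_bool (P e))"

abbreviation computable_list :: "((nat \<Rightarrow> nat) \<Rightarrow> nat list) \<Rightarrow> bool" where
  "computable_list L \<equiv> computable (\<lambda>e. list_encode (L e))"

section \<open>Programs, substitution and recursion\<close>

lemma computable_var: "computable (\<lambda>e. e i)"
  unfolding computable_def
proof (intro exI allI impI)
  fix e :: "nat \<Rightarrow> nat" and m assume "Suc i \<le> m"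
  then show "rec_eval (Proj i) (map e [0..<m]) (e i)"
    using rec_eval.Proj[of i "map e [0..<m]"] by simp
qed

text \<open>Composes \<open>r\<close> with programs for the \<open>G i\<close>. Only the tuples that
  actually arise matter, so \<open>r\<close> may diverge elsewhere, as a program for the word
  problem may on numbers that code no reduced word.\<close>

lemma computable_oracle:
  assumes "\<And>e. rec_eval r (map (\<lambda>i. G i e) [0..<n]) (H e)" and "\<And>i. computable (G i)"
  shows "computable H"
proof -
  obtain s k where s: "\<And>i e m. k i \<le> m \<Longrightarrow> rec_eval (s i) (map e [0..<m]) (G i e)"
    using assms(2) unfolding computable_def by metis
  show ?thesis
    unfolding computable_def
  proof (intro exI allI impI)
    \<comment> \<open>Each program \<open>s i\<close> has its own threshold \<open>k i\<close>; the
      sum dominates all of them.\<close>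
    fix e :: "nat \<Rightarrow> nat" and m assume m: "(\<Sum>i<n. k i) \<le> m"
    have "k i \<le> m" if "i < n" for i
      using that m member_le_sum[of i "{..<n}" k] by simp
    then have "list_all2 (\<lambda>g y. rec_eval g (map e [0..<m]) y) (map s [0..<n]) (map (\<lambda>i. G i e) [0..<n])"
      using s by (simp add: list_all2_conv_all_nth)
    then show "rec_eval (Comp r (map s [0..<n])) (map e [0..<m]) (H e)"
      using assms(1) by (rule rec_eval.Comp)
  qed
qed

lemma computable_subst:
  assumes "computable F" and "\<And>i. computable (G i)"
  shows "computable (\<lambda>e. F (\<lambda>i. G i e))"
proof -
  obtain r n where "\<And>e. rec_eval r (map e [0..<n]) (F e)"
    using assms(1) unfolding computable_def by blast
  then show ?thesis
    using assms(2) by (rule computable_oracle)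
qed

lemma computable_oracle1:
  assumes "\<And>e. rec_eval r [G e] (H e)" and "computable G"
  shows "computable H"
proof (rule computable_oracle[of r "\<lambda>_. G" "Suc 0"])
  show "rec_eval r (map (\<lambda>_. G e) [0..<Suc 0]) (H e)" for e
    using assms(1)[of e] by simp
qed (rule assms(2))

lemma computable_oracle2:
  assumes "\<And>e. rec_eval r [G e, G' e] (H e)" and "computable G" and "computable G'"
  shows "computable H"
proof (rule computable_oracle[of r "\<lambda>i. if i = 0 then G else G'" "Suc (Suc 0)"])
  show "rec_eval r (map (\<lambda>i. (if i = 0 then G else G') e) [0..<Suc (Suc 0)]) (H e)" for e
    using assms(1)[of e] by simp
  show "computable (if i = 0 then G else G')" for i :: nat
    using assms(2,3) by simp
qed

lemma computable_subst1:
  assumes "computable (\<lambda>e. f (e 0))" and "computable G"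
  shows "computable (\<lambda>e. f (G e))"
  using computable_subst[OF assms(1), of "\<lambda>_. G"] assms(2) by simp

text \<open>The body of a recursion finds its own two variables at positions 0 and 1 and the outer
  variables from position 2 on; all of them are substituted at once.\<close>

lemma computable_subst_tail:
  assumes "computable (\<lambda>e. B (e 0) (e 1) (\<lambda>j. e (Suc (Suc j))))"
    and "computable G" and "computable H" and "\<And>j. computable (K j)"
  shows "computable (\<lambda>e. B (G e) (H e) (\<lambda>j. K j e))"
  using computable_subst[OF assms(1), of "case_nat G (case_nat H K)"] assms(2-)
  by (simp split: nat.split)

text \<open>Weakening: a bound variable takes position 0 and pushes the outer variables up by
  one.\<close>

lemma computable_shift: "computable F \<Longrightarrow> computable (\<lambda>e. F (\<lambda>j. e (Suc j)))"
  by (erule computable_subst) (rule computable_var)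

lemma computable_shift2: "computable F \<Longrightarrow> computable (\<lambda>e. F (\<lambda>j. e (Suc (Suc j))))"
  by (erule computable_subst) (rule computable_var)

lemma computable_0: "computable (\<lambda>_. 0)"
  unfolding computable_def by (blast intro: rec_eval.Zero)

lemma computable_Suc:
  assumes "computable F"
  shows "computable (\<lambda>e. Suc (F e))"
  using rec_eval.Succ assms by (rule computable_oracle1)

lemma computable_const: "computable (\<lambda>_. c)"
  by (induction c) (auto intro: computable_0 computable_Suc)

text \<open>The positions follow the convention of \<open>PrimRec\<close>: counter, previous value,
  then the parameters.\<close>

lemma computable_rec_nat:
  assumes "computable A" and "computable (\<lambda>e. B (e 0) (e 1) (\<lambda>j. e (Suc (Suc j))))"
    and "computable H"
  shows "computable (\<lambda>e. rec_nat (A e) (\<lambda>i y. B i y e) (H e))"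
proof -
  obtain a nA where a: "\<And>e m. nA \<le> m \<Longrightarrow> rec_eval a (map e [0..<m]) (A e)"
    using assms(1) unfolding computable_def by blast
  obtain b nB where b: "\<And>e m. nB \<le> m \<Longrightarrow>
      rec_eval b (map e [0..<m]) (B (e 0) (e 1) (\<lambda>j. e (Suc (Suc j))))"
    using assms(2) unfolding computable_def by blast
  \<comment> \<open>One number of parameters that is large enough for both programs.\<close>
  define n where "n = nA + nB"
  have cons: "x # map e [0..<k] = map (case_nat x e) [0..<Suc k]" for x :: nat and e k
    by (simp add: map_upt_Suc del: upt_Suc)
  have rec: "rec_eval (PrimRec a b) (k # map e [0..<n]) (rec_nat (A e) (\<lambda>i y. B i y e) k)" for k e
  proof (induction k)
    case 0
    then show ?case using a[of n e] by (simp add: n_def rec_eval.PrimRec_0)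
  next
    case (Suc k)
    let ?y = "rec_nat (A e) (\<lambda>i y. B i y e) k"
    have "rec_eval b (k # ?y # map e [0..<n]) (B k ?y e)"
      unfolding cons using b[of "Suc (Suc n)" "case_nat k (case_nat ?y e)"] by (simp add: n_def del: upt_Suc)
    with Suc.IH show ?case by (simp add: rec_eval.PrimRec_Suc)
  qed
  show ?thesis
  \<comment> \<open>The program expects the recursion argument \<open>H e\<close> in front of the
    first \<open>n\<close> variables.\<close>
  proof (rule computable_oracle[of "PrimRec a b" "case_nat H (\<lambda>i e. e i)" "Suc n"])
    show "rec_eval (PrimRec a b) (map (\<lambda>i. case_nat H (\<lambda>i e. e i) i e) [0..<Suc n])
        (rec_nat (A e) (\<lambda>i y. B i y e) (H e))" for e
      using rec[of "H e" e] by (simp add: map_upt_Suc del: upt_Suc)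
    show "computable (case_nat H (\<lambda>i e. e i) i)" for i
      using assms(3) by (cases i) (simp_all add: computable_var)
  qed
qed

text \<open>Unbounded search by \<open>Mu\<close> halts because a witness exists in every
  environment.\<close>

lemma computable_Least:
  assumes "decidable (\<lambda>e. P (e 0) (\<lambda>j. e (Suc j)))" and "\<And>e. \<exists>n. P n e"
  shows "computable (\<lambda>e. LEAST n. P n e)"
proof -
  \<comment> \<open>\<open>Mu\<close> looks for a zero, so the truth value has to be negated; this
    recursion exchanges 0 and 1.\<close>
  have "computable (\<lambda>e. rec_nat 1 (\<lambda>_ _. 0) (of_bool (P (e 0) (\<lambda>j. e (Suc j)))))"
    by (intro computable_rec_nat computable_const assms)
  moreover have "rec_nat 1 (\<lambda>_ _. 0) (of_bool Q) = (of_bool (\<not> Q) :: nat)" for Q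
    by simp
  ultimately obtain r n where
    r: "\<And>e m. n \<le> m \<Longrightarrow> rec_eval r (map e [0..<m]) (of_bool (\<not> P (e 0) (\<lambda>j. e (Suc j))))"
    unfolding computable_def by auto
  have r': "rec_eval r (k # map e [0..<m]) (of_bool (\<not> P k e))" if "n \<le> m" for k e m
    using r[of "Suc m" "case_nat k e"] that by (simp add: map_upt_Suc del: upt_Suc)
  show ?thesis
    unfolding computable_def
  proof (intro exI allI impI)
    fix e :: "nat \<Rightarrow> nat" and m assume m: "n \<le> m"
    let ?k = "LEAST n. P n e"
    have "P ?k e" using assms(2) by (rule LeastI_ex)
    then have "rec_eval r (?k # map e [0..<m]) 0"
      using r'[OF m, of ?k e] by simp
    moreover have "\<exists>y. rec_eval r (i # map e [0..<m]) (Suc y)" if "i < ?k" for i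
      using r'[OF m, of i e] not_less_Least[OF that] by auto
    ultimately show "rec_eval (Mu r) (map e [0..<m]) ?k"
      by (intro rec_eval.Mu) auto
  qed
qed

section \<open>Arithmetic\<close>

lemma computable_add:
  assumes "computable F" and "computable G"
  shows "computable (\<lambda>e. F e + G e)"
proof -
  have "computable (\<lambda>e. rec_nat (F e) (\<lambda>_ y. Suc y) (G e))"
    by (intro computable_rec_nat computable_Suc computable_var assms)
  moreover have "rec_nat a (\<lambda>_ y. Suc y) b = a + b" for a b
    by (induction b) auto
  ultimately show ?thesis by simp
qed

lemma computable_mult:
  assumes "computable F" and "computable G"
  shows "computable (\<lambda>e. F e * G e)"
proof -
  have "computable (\<lambda>e. rec_nat 0 (\<lambda>_ y. y + F e) (G e))"
    by (intro computable_rec_nat computable_add computable_const computable_var computable_shift2 assms)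
  moreover have "rec_nat 0 (\<lambda>_ y. y + a) b = a * b" for a b
    by (induction b) auto
  ultimately show ?thesis by simp
qed

lemma computable_diff:
  assumes "computable F" and "computable G"
  shows "computable (\<lambda>e. F e - G e)"
proof -
  \<comment> \<open>The inner recursion returns its last counter, that is, the predecessor;
    iterating it gives truncated subtraction.\<close>
  have "computable (\<lambda>e. rec_nat (F e) (\<lambda>_ y. rec_nat 0 (\<lambda>i _. i) y) (G e))"
    by (intro computable_rec_nat computable_const computable_var assms)
  moreover have "rec_nat 0 (\<lambda>i _. i) y = y - 1" for y :: nat
    by (cases y) auto
  moreover have "rec_nat a (\<lambda>_ y. y - 1) b = a - b" for a b
    by (induction b) auto
  ultimately show ?thesis by simp
qed

lemmas computable_arith = computable_var computable_const computable_Suc computable_add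
  computable_mult computable_diff

section \<open>Decidable predicates and bounded quantifiers\<close>

lemma decidable_not:
  assumes "decidable P"
  shows "decidable (\<lambda>e. \<not> P e)"
proof -
  have "computable (\<lambda>e. 1 - of_bool (P e))"
    by (intro computable_arith assms)
  moreover have "1 - of_bool b = (of_bool (\<not> b) :: nat)" for b
    by simp
  ultimately show ?thesis by (simp only:)
qed

lemma decidable_conj:
  assumes "decidable P" and "decidable Q"
  shows "decidable (\<lambda>e. P e \<and> Q e)"
  using computable_mult[OF assms] by (simp only: of_bool_conj)

lemma decidable_imp:
  assumes "decidable P" and "decidable Q"
  shows "decidable (\<lambda>e. P e \<longrightarrow> Q e)"
  using decidable_not[OF decidable_conj[OF assms(1) decidable_not[OF assms(2)]]]
  by simp

lemma decidable_le:
  assumes "computable F" and "computable G"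
  shows "decidable (\<lambda>e. F e \<le> G e)"
proof -
  have "computable (\<lambda>e. 1 - (F e - G e))"
    by (intro computable_arith assms)
  moreover have "1 - (a - b) = (of_bool (a \<le> b) :: nat)" for a b :: nat
    by simp
  ultimately show ?thesis by (simp only:)
qed

lemma decidable_eq:
  assumes "computable F" and "computable G"
  shows "decidable (\<lambda>e. F e = G e)"
  unfolding order.eq_iff by (intro decidable_conj decidable_le assms)

lemma decidable_less:
  assumes "computable F" and "computable G"
  shows "decidable (\<lambda>e. F e < G e)"
  unfolding less_eq_Suc_le by (intro decidable_le computable_Suc assms)

text \<open>A primitive recursion carries a flag that records whether a witness has been
  met.\<close>

lemma decidable_ex_le:
  assumes "decidable (\<lambda>e. P (e 0) (\<lambda>j. e (Suc j)))" and "computable F"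
  shows "decidable (\<lambda>e. \<exists>i\<le>F e. P i e)"
proof -
  \<comment> \<open>In the step function the flag occupies position 1, so \<open>P\<close> has to
    skip it.\<close>
  have "decidable (\<lambda>e. P (e 0) (\<lambda>j. e (Suc (Suc j))))"
    using computable_subst[OF assms(1), of "case_nat (\<lambda>e. e 0) (\<lambda>j e. e (Suc (Suc j)))"]
    by (simp add: computable_var split: nat.split)
  \<comment> \<open>The negated conjunction says \<open>y \<noteq> 0 \<or> P i e\<close>. The bound
    is inclusive, hence \<open>Suc (F e)\<close> rounds.\<close>
  then have "computable (\<lambda>e. rec_nat 0 (\<lambda>i y. of_bool (\<not> (y = 0 \<and> \<not> P i e))) (Suc (F e)))"
    by (intro computable_rec_nat computable_arith decidable_eq decidable_not decidable_conj assms)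
  moreover have "rec_nat 0 (\<lambda>i y. of_bool (\<not> (y = 0 \<and> \<not> P i e))) n = (of_bool (\<exists>i<n. P i e) :: nat)" for e n
    by (induction n) (auto simp: less_Suc_eq)
  ultimately show ?thesis by (simp only: less_Suc_eq_le)
qed

lemma decidable_all_le:
  assumes "decidable (\<lambda>e. P (e 0) (\<lambda>j. e (Suc j)))" and "computable F"
  shows "decidable (\<lambda>e. \<forall>i\<le>F e. P i e)"
  using decidable_not[OF decidable_ex_le[OF decidable_not[OF assms(1)] assms(2)]] by simp

lemma decidable_even:
  assumes "computable F"
  shows "decidable (\<lambda>e. even (F e))"
proof -
  have "computable (\<lambda>e. rec_nat 1 (\<lambda>_ y. 1 - y) (F e))"
    by (intro computable_rec_nat computable_arith assms)
  moreover have "rec_nat 1 (\<lambda>_ y. 1 - y) n = (of_bool (even n) :: nat)" for n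
    by (induction n) auto
  ultimately show ?thesis by simp
qed

lemmas decidable_logic = decidable_not decidable_conj decidable_imp decidable_le decidable_eq
  decidable_less decidable_even

lemma computable_if:
  assumes "decidable P" and "computable F" and "computable G"
  shows "computable (\<lambda>e. if P e then F e else G e)"
proof -
  have "computable (\<lambda>e. of_bool (P e) * F e + (1 - of_bool (P e)) * G e)"
    by (intro computable_arith assms)
  moreover have "of_bool b * x + (1 - of_bool b) * y = (if b then x else y)" for b and x y :: nat
    by simp
  ultimately show ?thesis by (simp only:)
qed

text \<open>A program for the functional may demand more than two arguments; the two inputs are
  padded with \<open>n\<close> zeros.\<close>

lemma computable2_if_computable:
  assumes "computable (\<lambda>e. f (e 0) (e 1))"
  shows "computable2 f"
proof -
  obtain r n where r: "\<And>e m. n \<le> m \<Longrightarrow> rec_eval r (map e [0..<m]) (f (e 0) (e 1))"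
    using assms unfolding computable_def by blast
  define gs where "gs = Proj 0 # Proj 1 # map (\<lambda>_. Zero) [0..<n]"
  have "rec_eval (Comp r gs) [x, y] (f x y)" for x y
  proof (rule rec_eval.Comp)
    have "rec_eval (Proj 0) [x, y] x" "rec_eval (Proj 1) [x, y] y"
      using rec_eval.Proj[of 0 "[x, y]"] rec_eval.Proj[of 1 "[x, y]"] by simp_all
    then show "list_all2 (\<lambda>g. rec_eval g [x, y]) gs (x # y # map (\<lambda>_. 0) [0..<n])"
      by (simp add: gs_def list.rel_map list.rel_refl rec_eval.Zero)
    show "rec_eval r (x # y # map (\<lambda>_. 0) [0..<n]) (f x y)"
      using r[of "Suc (Suc n)" "case_nat x (case_nat y (\<lambda>_. 0))"]
      by (simp add: map_upt_Suc del: upt_Suc)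
  qed
  then show ?thesis unfolding computable2_def by blast
qed

lemma computable_if_computable2:
  assumes "computable2 f" and "computable F" and "computable G"
  shows "computable (\<lambda>e. f (F e) (G e))"
  using assms unfolding computable2_def by (blast intro: computable_oracle2)


section \<open>Computing with lists\<close>

lemma computable_prod_encode:
  assumes "computable F" and "computable G"
  shows "computable (\<lambda>e. prod_encode (F e, G e))"
proof -
  have "computable (\<lambda>e. rec_nat 0 (\<lambda>i y. y + Suc i) (F e + G e) + F e)"
    by (intro computable_rec_nat computable_arith assms)
  moreover have "rec_nat 0 (\<lambda>i y. y + Suc i) n = triangle n" for n
    by (induction n) auto
  ultimately show ?thesis by (simp add: prod_encode_def)
qed

text \<open>Each component is found by search. A code is at least as large as both components, so
  the quantifier over the other component is bounded.\<close>

lemma computable_prod_decode: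
  assumes "computable F"
  shows "computable (\<lambda>e. fst (prod_decode (F e)))" (is ?fst)
    and "computable (\<lambda>e. snd (prod_decode (F e)))" (is ?snd)
proof -
  have fst: "(LEAST a. \<exists>b\<le>c. prod_encode (a, b) = c) = fst (prod_decode c)" (is "_ = ?a") for c
  proof (rule Least_equality)
    show "\<exists>b\<le>c. prod_encode (?a, b) = c"
      using le_prod_encode_2[of "snd (prod_decode c)" ?a] by (intro exI[of _ "snd (prod_decode c)"]) simp
  qed auto
  have snd: "(LEAST b. \<exists>a\<le>c. prod_encode (a, b) = c) = snd (prod_decode c)" (is "_ = ?b") for c
  proof (rule Least_equality)
    show "\<exists>a\<le>c. prod_encode (a, ?b) = c"
      using le_prod_encode_1[of "fst (prod_decode c)" ?b] by (intro exI[of _ "fst (prod_decode c)"]) simp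
  qed auto
  have "computable (\<lambda>e. LEAST a. \<exists>b\<le>F e. prod_encode (a, b) = F e)"
  proof (rule computable_Least)
    show "\<exists>a. \<exists>b\<le>F e. prod_encode (a, b) = F e" for e
      by (metis le_prod_encode_2 prod_decode_inverse surj_pair)
  qed (intro decidable_ex_le decidable_eq computable_prod_encode computable_arith computable_shift computable_shift2 assms)
  then show ?fst by (simp only: fst)
  have "computable (\<lambda>e. LEAST b. \<exists>a\<le>F e. prod_encode (a, b) = F e)"
  proof (rule computable_Least)
    show "\<exists>b. \<exists>a\<le>F e. prod_encode (a, b) = F e" for e
      by (metis le_prod_encode_1 prod_decode_inverse surj_pair)
  qed (intro decidable_ex_le decidable_eq computable_prod_encode computable_arith computable_shift computable_shift2 assms)
  then show ?snd by (simp only: snd)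
qed

section \<open>List operations and folds\<close>

lemma computable_list_decode: "computable F \<Longrightarrow> computable_list (\<lambda>e. list_decode (F e))"
  by simp

lemma computable_Nil: "computable_list (\<lambda>_. [])"
  by (rule computable_const)

lemma computable_Cons:
  assumes "computable F" and "computable_list L"
  shows "computable_list (\<lambda>e. F e # L e)"
  by (simp, intro computable_Suc computable_prod_encode assms)

lemma decidable_list_eq:
  assumes "computable_list L" and "computable_list M"
  shows "decidable (\<lambda>e. L e = M e)"
  using decidable_eq[OF assms] by (simp add: list_encode_eq)

lemma computable_hd:
  assumes "computable_list L"
  shows "computable (\<lambda>e. hd (L e))"
proof -
  \<comment> \<open>\<open>hd []\<close> is some fixed number, hence a computable constant. A
    nonempty list is coded by the successor of a pair.\<close>
  have "computable (\<lambda>e. if L e = [] then hd [] else fst (prod_decode (list_encode (L e) - 1)))"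
    by (intro computable_if decidable_list_eq computable_prod_decode computable_arith assms computable_Nil)
  moreover have "(if l = [] then hd [] else fst (prod_decode (list_encode l - 1))) = hd l" for l
    by (cases l) auto
  ultimately show ?thesis by (simp only:)
qed

lemma computable_tl:
  assumes "computable_list L"
  shows "computable_list (\<lambda>e. tl (L e))"
proof -
  have "computable (\<lambda>e. if L e = [] then 0 else snd (prod_decode (list_encode (L e) - 1)))"
    by (intro computable_if decidable_list_eq computable_prod_decode computable_arith assms computable_Nil)
  moreover have "(if l = [] then 0 else snd (prod_decode (list_encode l - 1))) = list_encode (tl l)" for l
    by (cases l) auto
  ultimately show ?thesis by (simp only:)
qed

lemma computable_drop:
  assumes "computable_list L" and "computable F"
  shows "computable_list (\<lambda>e. drop (F e) (L e))"
proof -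
  have "computable (\<lambda>e. rec_nat (list_encode (L e)) (\<lambda>_ y. list_encode (tl (list_decode y))) (F e))"
    by (intro computable_rec_nat computable_tl computable_list_decode computable_arith assms)
  moreover have "rec_nat (list_encode l) (\<lambda>_ y. list_encode (tl (list_decode y))) n = list_encode (drop n l)" for l n
    by (induction n) (auto simp: drop_Suc tl_drop)
  ultimately show ?thesis by simp
qed

text \<open>The code of a list serves as a number of rounds sufficient to traverse it.\<close>

lemma length_le_list_encode: "length l \<le> list_encode l"
proof (induction l)
  case (Cons a l)
  then show ?case using le_prod_encode_2[of "list_encode l" a] by simp
qed simp

text \<open>After \<open>n\<close> rounds the value is the fold over the first \<open>n\<close>
  entries; once the list is exhausted the value no longer changes, so surplus rounds are
  harmless.\<close>

lemma foldl_eq_rec_nat: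
  assumes "length l \<le> n"
  shows "rec_nat a (\<lambda>i y. if drop i l = [] then y else f y (hd (drop i l))) n = foldl f a l"
proof -
  have "rec_nat a (\<lambda>i y. if drop i l = [] then y else f y (hd (drop i l))) n = foldl f a (take n l)" for n
    by (induction n) (auto simp: hd_drop_conv_nth take_Suc_conv_app_nth)
  then show ?thesis using assms by simp
qed

lemma computable_foldl:
  assumes "computable A" and "computable (\<lambda>e. B (e 0) (e 1) (\<lambda>j. e (Suc (Suc j))))"
    and "computable_list L"
  shows "computable (\<lambda>e. foldl (\<lambda>y a. B y a e) (A e) (L e))"
proof -
  have "computable (\<lambda>e. rec_nat (A e)
      (\<lambda>i y. if drop i (L e) = [] then y else B y (hd (drop i (L e))) e) (list_encode (L e)))"
  proof (intro computable_rec_nat computable_if)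
    have drop: "computable_list (\<lambda>e. drop (e 0) (L (\<lambda>j. e (Suc (Suc j)))))"
      using assms(3) by (intro computable_drop computable_var) (rule computable_shift2)
    then show "computable (\<lambda>e. B (e 1) (hd (drop (e 0) (L (\<lambda>j. e (Suc (Suc j)))))) (\<lambda>j. e (Suc (Suc j))))"
      by (intro computable_subst_tail[OF assms(2)] computable_hd computable_var)
    show "decidable (\<lambda>e. drop (e 0) (L (\<lambda>j. e (Suc (Suc j)))) = [])"
      using drop computable_Nil by (rule decidable_list_eq)
  qed (intro computable_var assms)+
  moreover have "rec_nat (A e) (\<lambda>i y. if drop i (L e) = [] then y else B y (hd (drop i (L e))) e) (list_encode (L e)) =
      foldl (\<lambda>y a. B y a e) (A e) (L e)" for e
    using length_le_list_encode by (rule foldl_eq_rec_nat)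
  ultimately show ?thesis by (simp only:)
qed

text \<open>The accumulator is kept as a code and decoded inside the body.\<close>

lemma computable_list_foldl:
  assumes "computable_list A"
    and "computable_list (\<lambda>e. B (list_decode (e 0)) (e 1) (\<lambda>j. e (Suc (Suc j))))"
    and "computable_list L"
  shows "computable_list (\<lambda>e. foldl (\<lambda>y a. B y a e) (A e) (L e))"
proof -
  have "computable (\<lambda>e. foldl (\<lambda>y a. list_encode (B (list_decode y) a e)) (list_encode (A e)) (L e))"
    using assms by (rule computable_foldl)
  moreover have "foldl (\<lambda>y a. list_encode (B (list_decode y) a e)) (list_encode x) l =
      list_encode (foldl (\<lambda>y a. B y a e) x l)" for e x l
    by (induction l arbitrary: x) auto
  ultimately show ?thesis by (simp only:)
qed

text \<open>Prepending during a left fold reverses the list. This yields right folds below and is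
  also the shape of an inverse word.\<close>

lemma computable_rev_map:
  assumes "computable (\<lambda>e. f (e 0))" and "computable_list L"
  shows "computable_list (\<lambda>e. rev (map f (L e)))"
proof -
  have "computable_list (\<lambda>e. foldl (\<lambda>y a. f a # y) [] (L e))"
    by (intro computable_list_foldl computable_Nil computable_Cons computable_list_decode
        computable_var computable_subst1[OF assms(1)] assms)
  moreover have "foldl (\<lambda>y a. f a # y) y l = rev (map f l) @ y" for y l
    by (induction l arbitrary: y) auto
  ultimately show ?thesis by simp
qed

text \<open>A right fold is a left fold over the reversed list, with the two arguments of the body
  exchanged.\<close>

lemma computable_list_foldr:
  assumes "computable_list A"
    and "computable_list (\<lambda>e. B (e 1) (list_decode (e 0)) (\<lambda>j. e (Suc (Suc j))))"
    and "computable_list L"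
  shows "computable_list (\<lambda>e. foldr (\<lambda>a y. B a y e) (L e) (A e))"
  using computable_list_foldl[OF assms(1,2) computable_rev_map[of "\<lambda>x. x", OF computable_var assms(3)]]
  by (simp add: foldr_conv_foldl)

lemma computable_append:
  assumes "computable_list L" and "computable_list M"
  shows "computable_list (\<lambda>e. L e @ M e)"
proof -
  have "computable_list (\<lambda>e. foldr (\<lambda>a y. a # y) (L e) (M e))"
    by (intro computable_list_foldr computable_Cons computable_list_decode computable_var assms)
  moreover have "foldr (\<lambda>a y. a # y) l y = l @ y" for l y :: "nat list"
    by (induction l) auto
  ultimately show ?thesis by simp
qed

lemma computable_length:
  assumes "computable_list L"
  shows "computable (\<lambda>e. length (L e))"
proof -
  have "computable (\<lambda>e. foldl (\<lambda>y _. Suc y) 0 (L e))"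
    by (intro computable_foldl computable_arith assms)
  moreover have "foldl (\<lambda>y _. Suc y) n l = n + length l" for n and l :: "nat list"
    by (induction l arbitrary: n) auto
  ultimately show ?thesis by simp
qed

lemma decidable_list_all_less:
  assumes "computable_list L"
  shows "decidable (\<lambda>e. \<forall>a\<in>set (L e). a < k)"
proof -
  have "computable (\<lambda>e. foldl (\<lambda>y a. y * of_bool (a < k)) 1 (L e))"
    by (intro computable_foldl computable_arith decidable_less assms)
  moreover have "foldl (\<lambda>y a. y * of_bool (a < k)) y l = y * of_bool (\<forall>a\<in>set l. a < k)" for y :: nat and l
    by (induction l arbitrary: y) auto
  ultimately show ?thesis by simp
qed

text \<open>This is the code of the list of \<open>n\<close> copies of \<open>k\<close>. It bounds
  the numerical search for words of length at most \<open>n\<close>.\<close>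

fun list_code_bound :: "nat \<Rightarrow> nat \<Rightarrow> nat" where
  "list_code_bound k 0 = 0"
| "list_code_bound k (Suc n) = Suc (prod_encode (k, list_code_bound k n))"

lemma computable_list_code_bound:
  assumes "computable F"
  shows "computable (\<lambda>e. list_code_bound k (F e))"
proof -
  have "computable (\<lambda>e. rec_nat 0 (\<lambda>_ y. Suc (prod_encode (k, y))) (F e))"
    by (intro computable_rec_nat computable_prod_encode computable_arith assms)
  moreover have "rec_nat 0 (\<lambda>_ y. Suc (prod_encode (k, y))) n = list_code_bound k n" for n
    by (induction n) auto
  ultimately show ?thesis by simp
qed

lemma prod_encode_mono: "a \<le> a' \<Longrightarrow> b \<le> b' \<Longrightarrow> prod_encode (a, b) \<le> prod_encode (a', b')"
  by (auto simp: prod_encode_def triangle_def intro!: add_mono div_le_mono mult_le_mono)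

text \<open>Raising the entries to \<open>k\<close> and extending the list can only increase the
  code, since pairing is monotone and the empty list has code 0.\<close>

lemma list_encode_le_list_code_bound:
  "\<forall>a\<in>set l. a < k \<Longrightarrow> length l \<le> n \<Longrightarrow> list_encode l \<le> list_code_bound k n"
proof (induction l arbitrary: n)
  case (Cons a l)
  then obtain m where "n = Suc m" by (cases n) auto
  with Cons show ?case by (auto intro: prod_encode_mono)
qed simp


section \<open>Computing with words\<close>

text \<open>Codes \<open>2 * i\<close> and \<open>2 * i + 1\<close> belong to the inverse of a
  generator and to the generator itself, so inversion exchanges them.\<close>

definition code_inv :: "nat \<Rightarrow> nat" where
  "code_inv a = (if even a then Suc a else a - 1)"

text \<open>Counterpart of \<open>cons_cancel\<close> on letter codes.\<close>

definition code_cancel :: "nat \<Rightarrow> nat list \<Rightarrow> nat list" where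
  "code_cancel a l = (if l \<noteq> [] \<and> hd l = code_inv a then tl l else a # l)"

definition code_reduce :: "nat list \<Rightarrow> nat list" where
  "code_reduce l = foldr code_cancel l []"

lemma computable_code_inv: "computable F \<Longrightarrow> computable (\<lambda>e. code_inv (F e))"
  unfolding code_inv_def by (intro computable_if decidable_even computable_arith)

lemma computable_code_reduce:
  assumes "computable_list L"
  shows "computable_list (\<lambda>e. code_reduce (L e))"
proof -
  have "computable_list (\<lambda>e. code_cancel (e 1) (list_decode (e 0)))"
    unfolding code_cancel_def if_distrib[of list_encode]
    by (intro computable_if decidable_logic decidable_list_eq computable_hd computable_tl computable_Cons
        computable_Nil computable_list_decode computable_code_inv computable_var)
  then show ?thesis
    unfolding code_reduce_def by (intro computable_list_foldr computable_Nil assms)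
qed

lemma letter_code_inv_letter: "letter_code X (inv_letter a) = code_inv (letter_code X a)"
  by (cases "snd a") (auto simp: letter_code_def code_inv_def inv_letter_def)

text \<open>Halving a code gives the index of the generator and parity gives the sign. Being a
  letter code thus becomes the decidable condition of lying below \<open>2 * card X\<close>.\<close>

lemma bij_betw_letter_code:
  assumes "finite X"
  shows "bij_betw (letter_code X) (X \<times> UNIV) {..<2 * card X}"
proof (rule bij_betw_imageI)
  have bij: "bij_betw (to_nat_on X) X {..<card X}"
    using assms by (rule to_nat_on_finite)
  show "inj_on (letter_code X) (X \<times> UNIV)"
  proof (rule inj_onI)
    fix a b assume ab: "a \<in> X \<times> (UNIV :: bool set)" "b \<in> X \<times> UNIV" "letter_code X a = letter_code X b"
    from ab(3) have "to_nat_on X (fst a) = to_nat_on X (fst b) \<and> snd a = snd b"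
      unfolding letter_code_def by (cases "snd a"; cases "snd b"; simp; presburger)
    moreover have "fst a \<in> X" "fst b \<in> X"
      using ab by auto
    ultimately show "a = b"
      using bij_betw_imp_inj_on[OF bij] by (auto simp: prod_eq_iff dest: inj_onD)
  qed
  show "letter_code X ` (X \<times> UNIV) = {..<2 * card X}"
  proof (intro equalityI subsetI)
    fix c assume "c \<in> {..<2 * card X}"
    then have "c div 2 \<in> {..<card X}" by simp
    then obtain x where "x \<in> X" "to_nat_on X x = c div 2"
      using bij by (metis bij_betw_iff_bijections)
    then have "c = letter_code X (x, odd c)" "(x, odd c) \<in> X \<times> UNIV"
      by (simp_all add: letter_code_def)
    then show "c \<in> letter_code X ` (X \<times> UNIV)" by blast
  next
    fix c assume "c \<in> letter_code X ` (X \<times> UNIV)"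
    then obtain x b where xb: "x \<in> X" "c = letter_code X (x, b)" by auto
    then have "to_nat_on X x < card X"
      using bij by (auto simp: bij_betw_def)
    with xb show "c \<in> {..<2 * card X}"
      by (cases b) (auto simp: letter_code_def)
  qed
qed

lemma map_letter_code_cons_cancel:
  assumes "finite X" and "a \<in> X \<times> UNIV" and "set w \<subseteq> X \<times> UNIV"
  shows "map (letter_code X) (cons_cancel a w) = code_cancel (letter_code X a) (map (letter_code X) w)"
proof (cases w)
  case (Cons b v)
  have "inv_letter a \<in> X \<times> UNIV" "b \<in> X \<times> UNIV"
    using assms Cons by (auto simp: inv_letter_def)
  then have "letter_code X b = code_inv (letter_code X a) \<longleftrightarrow> b = inv_letter a"
    using bij_betw_letter_code[OF assms(1)]
    by (metis bij_betw_imp_inj_on inj_onD letter_code_inv_letter)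
  with Cons show ?thesis by (simp add: code_cancel_def)
qed (simp add: code_cancel_def)

lemma map_letter_code_reduce:
  assumes "finite X" and "set w \<subseteq> X \<times> UNIV"
  shows "map (letter_code X) (reduce w) = code_reduce (map (letter_code X) w)"
  using assms(2)
proof (induction w)
  case (Cons a w)
  then have "set (reduce w) \<subseteq> X \<times> UNIV"
    using set_reduce[of w] by auto
  with Cons show ?case
    using map_letter_code_cons_cancel[OF assms(1), of a "reduce w"]
    by (simp add: reduce_def code_reduce_def)
qed (simp add: reduce_def code_reduce_def)

section \<open>Recognising reduced and cyclically reduced words from their codes\<close>

lemma reduced_iff_reduce: "reduced w \<longleftrightarrow> reduce w = w"
  using reduce_reduced[of w] reduced_reduce[of w] by auto

lemma reduced_iff_code_reduce:
  assumes "finite X" and "set w \<subseteq> X \<times> UNIV"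
  shows "reduced w \<longleftrightarrow> code_reduce (map (letter_code X) w) = map (letter_code X) w"
proof -
  have "inj_on (letter_code X) (X \<times> UNIV)"
    using bij_betw_letter_code[OF assms(1)] by (rule bij_betw_imp_inj_on)
  then have "map (letter_code X) (reduce w) = map (letter_code X) w \<longleftrightarrow> reduce w = w"
    using assms(2) set_reduce[of w] by (auto intro: map_inj_on inj_on_subset)
  then show ?thesis
    by (simp add: reduced_iff_reduce map_letter_code_reduce[OF assms])
qed

lemma reduced_append:
  "reduced (u @ v) \<longleftrightarrow>
    reduced u \<and> reduced v \<and> (u \<noteq> [] \<longrightarrow> v \<noteq> [] \<longrightarrow> hd v \<noteq> inv_letter (last u))"
proof (induction u)
  case (Cons a u)
  then show ?case by (cases u; cases v) auto
qed simp

text \<open>At the seam of \<open>w @ w\<close> the last letter of \<open>w\<close> meets the first.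
  Cyclic reducedness thus becomes a test for reducedness, which is already available on
  codes.\<close>

lemma cyclically_reduced_iff:
  assumes "reduced w"
  shows "cyclically_reduced w \<longleftrightarrow> reduced (w @ w)"
  using assms by (auto simp: cyclically_reduced_def reduced_append)

text \<open>A decidable test for valid codes: every entry is a letter code, and reduction changes
  nothing.\<close>

lemma mem_image_word_code_iff:
  assumes "finite X"
  shows "c \<in> word_code X ` carrier (free_group X) \<longleftrightarrow>
    (\<forall>a\<in>set (list_decode c). a < 2 * card X) \<and> code_reduce (list_decode c) = list_decode c"
    (is "_ \<longleftrightarrow> ?valid")
proof
  assume "c \<in> word_code X ` carrier (free_group X)"
  then obtain w where w: "set w \<subseteq> X \<times> UNIV" "reduced w" "list_decode c = map (letter_code X) w"
    by (auto simp: free_group_def word_code_def)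
  moreover have "letter_code X a < 2 * card X" if "a \<in> set w" for a
    using that w(1) bij_betw_apply[OF bij_betw_letter_code[OF assms]] by blast
  ultimately show ?valid
    using reduced_iff_code_reduce[OF assms w(1)] by auto
next
  assume valid: ?valid
  then have "set (list_decode c) \<subseteq> letter_code X ` (X \<times> UNIV)"
    using bij_betw_imp_surj_on[OF bij_betw_letter_code[OF assms]] by auto
  then have "list_decode c \<in> lists (letter_code X ` (X \<times> UNIV))"
    by blast
  then obtain w where w: "set w \<subseteq> X \<times> UNIV" "list_decode c = map (letter_code X) w"
    unfolding lists_image by blast
  with valid have "reduced w"
    using reduced_iff_code_reduce[OF assms w(1)] by simp
  moreover have "c = word_code X w"
    unfolding word_code_def w(2)[symmetric] by simp
  ultimately show "c \<in> word_code X ` carrier (free_group X)"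
    using w(1) by (auto simp: free_group_def)
qed

text \<open>Numbers that code no reduced word are sent to the empty word. The algorithms given for the
  word problem and the conjugacy problem are thus only ever run on inputs on which they halt.\<close>

definition word_decode :: "'a set \<Rightarrow> nat \<Rightarrow> 'a gword" where
  "word_decode X c = (if c \<in> word_code X ` carrier (free_group X)
     then inv_into (carrier (free_group X)) (word_code X) c else [])"

lemma word_decode_carrier: "word_decode X c \<in> carrier (free_group X)"
proof (cases "c \<in> word_code X ` carrier (free_group X)")
  case True
  then show ?thesis by (simp add: word_decode_def inv_into_into)
qed (simp add: word_decode_def free_group_def)

lemma word_decode_word_code:
  assumes "finite X" and "w \<in> carrier (free_group X)"
  shows "word_decode X (word_code X w) = w"
  using assms by (simp add: word_decode_def inj_on_word_code)

lemma computable_word_code_word_decode: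
  assumes "finite X" and "computable F"
  shows "computable (\<lambda>e. word_code X (word_decode X (F e)))"
proof -
  \<comment> \<open>The default 0 is the code of the empty word, to which \<open>word_decode\<close>
    sends invalid codes.\<close>
  have "computable (\<lambda>e. if (\<forall>a\<in>set (list_decode (F e)). a < 2 * card X) \<and>
      code_reduce (list_decode (F e)) = list_decode (F e) then F e else 0)"
    by (intro computable_if decidable_conj decidable_list_all_less decidable_list_eq
        computable_code_reduce computable_list_decode computable_const assms)
  moreover have "word_code X (word_decode X c) =
      (if c \<in> word_code X ` carrier (free_group X) then c else 0)" for c
    by (auto simp: word_decode_def f_inv_into_f) (simp add: word_code_def)
  ultimately show ?thesis
    by (simp only: mem_image_word_code_iff[OF assms(1)])
qed

lemma computable_letter_codes:
  assumes "finite X" and "computable F"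
  shows "computable_list (\<lambda>e. map (letter_code X) (word_decode X (F e)))"
  using computable_word_code_word_decode[OF assms] by (simp add: word_code_def)

lemma computable_length_word_decode:
  assumes "finite X" and "computable F"
  shows "computable (\<lambda>e. length (word_decode X (F e)))"
  using computable_length[OF computable_letter_codes[OF assms]] by simp

lemma decidable_cyclically_reduced:
  assumes "finite X" and "computable F"
  shows "decidable (\<lambda>e. cyclically_reduced (word_decode X (F e)))"
proof -
  have w: "set (word_decode X c @ word_decode X c) \<subseteq> X \<times> UNIV" "reduced (word_decode X c)" for c
    using word_decode_carrier[of X c] by (auto simp: free_group_def)
  show ?thesis
    unfolding cyclically_reduced_iff[OF w(2)] reduced_iff_code_reduce[OF assms(1) w(1)]
    unfolding map_append
    by (intro decidable_list_eq computable_code_reduce computable_append computable_letter_codes assms)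
qed

section \<open>Bounded search over words\<close>

lemma word_code_le_list_code_bound:
  assumes "finite X" and "w \<in> carrier (free_group X)" and "length w \<le> n"
  shows "word_code X w \<le> list_code_bound (2 * card X) n"
  unfolding word_code_def
proof (rule list_encode_le_list_code_bound)
  show "\<forall>a\<in>set (map (letter_code X) w). a < 2 * card X"
    using assms(2) bij_betw_apply[OF bij_betw_letter_code[OF assms(1)]]
    by (auto simp: free_group_def)
qed (use assms in simp)

text \<open>Short words have small codes, and every number decodes to an element of the free group.
  The length test remains because small codes may also belong to longer words.\<close>

lemma ex_word_iff_ex_code:
  assumes "finite X"
  shows "(\<exists>t\<in>carrier (free_group X). length t \<le> n \<and> P t) \<longleftrightarrow>
    (\<exists>c\<le>list_code_bound (2 * card X) n. length (word_decode X c) \<le> n \<and> P (word_decode X c))"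
proof
  assume "\<exists>t\<in>carrier (free_group X). length t \<le> n \<and> P t"
  then obtain t where "t \<in> carrier (free_group X)" "length t \<le> n" "P t" by blast
  then show "\<exists>c\<le>list_code_bound (2 * card X) n. length (word_decode X c) \<le> n \<and> P (word_decode X c)"
    using word_decode_word_code[OF assms] word_code_le_list_code_bound[OF assms]
    by (intro exI[of _ "word_code X t"]) simp
qed (use word_decode_carrier in blast)

lemma all_word_iff_all_code:
  assumes "finite X"
  shows "(\<forall>t\<in>carrier (free_group X). length t \<le> n \<longrightarrow> P t) \<longleftrightarrow>
    (\<forall>c\<le>list_code_bound (2 * card X) n. length (word_decode X c) \<le> n \<longrightarrow> P (word_decode X c))"
  using ex_word_iff_ex_code[OF assms, of n "\<lambda>t. \<not> P t"] by blast


section \<open>Conjugation in the presented group\<close>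

lemma inv_free_group: "w \<in> carrier (free_group X) \<Longrightarrow> inv\<^bsub>free_group X\<^esub> w = reduce (inv_word w)"
  by (intro group.inv_equality[OF group_free_group] inv_word_carrier)
    (auto simp: free_group_def reduce_append_left reduce_inv_word)

lemma group_hom_word_class:
  assumes "R \<subseteq> carrier (free_group X)"
  shows "group_hom (free_group X) (presented_group X R) (word_class X R)"
  using assms by (intro group_hom.intro group_hom_axioms.intro group_free_group
      group_presented_group word_class_hom)

text \<open>The equation \<open>u = t v t^-1\<close> holds iff \<open>t v t^-1 u^-1\<close> is
  trivial, so testing a conjugator is a single instance of the word problem.\<close>

lemma conjugates_by_iff_trivial_in:
  assumes "R \<subseteq> carrier (free_group X)"
    and "t \<in> carrier (free_group X)" "u \<in> carrier (free_group X)" "v \<in> carrier (free_group X)"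
  shows "conjugates_by X R t u v \<longleftrightarrow> trivial_in X R (reduce (t @ v @ inv_word t @ inv_word u))"
proof -
  interpret hom: group_hom "free_group X" "presented_group X R" "word_class X R"
    using assms(1) by (rule group_hom_word_class)
  let ?F = "free_group X" and ?G = "presented_group X R" and ?c = "word_class X R"
  have "reduce (((t @ v) @ inv_word t) @ inv_word u) = t \<otimes>\<^bsub>?F\<^esub> v \<otimes>\<^bsub>?F\<^esub> inv\<^bsub>?F\<^esub> t \<otimes>\<^bsub>?F\<^esub> inv\<^bsub>?F\<^esub> u"
    unfolding inv_free_group[OF assms(2)] inv_free_group[OF assms(3)]
    by (simp add: free_group_def reduce_append_left reduce_append_right del: append_assoc)
  then have "?c (reduce (t @ v @ inv_word t @ inv_word u)) =
      (?c t \<otimes>\<^bsub>?G\<^esub> ?c v \<otimes>\<^bsub>?G\<^esub> inv\<^bsub>?G\<^esub> ?c t) \<otimes>\<^bsub>?G\<^esub> inv\<^bsub>?G\<^esub> ?c u"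
    using assms by simp
  moreover have "x \<otimes>\<^bsub>?G\<^esub> inv\<^bsub>?G\<^esub> y = \<one>\<^bsub>?G\<^esub> \<longleftrightarrow> y = x" if "x \<in> carrier ?G" "y \<in> carrier ?G" for x y
    using that by (metis hom.H.inv_closed hom.H.inv_equality hom.H.inv_inv hom.H.r_inv)
  ultimately show ?thesis
    using assms by (simp add: conjugates_by_def trivial_in_def)
qed

lemma conjugates_by_mult:
  assumes "R \<subseteq> carrier (free_group X)"
    and "s \<in> carrier (free_group X)" "t \<in> carrier (free_group X)" "w \<in> carrier (free_group X)"
    and "conjugates_by X R s u v" and "conjugates_by X R t v w"
  shows "conjugates_by X R (reduce (s @ t)) u w"
proof -
  interpret hom: group_hom "free_group X" "presented_group X R" "word_class X R"
    using assms(1) by (rule group_hom_word_class)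
  have "reduce (s @ t) = s \<otimes>\<^bsub>free_group X\<^esub> t"
    by (simp add: free_group_def)
  then show ?thesis
    using assms by (simp add: conjugates_by_def hom.H.m_assoc hom.H.inv_mult_group)
qed

lemma conjugates_by_inv_word:
  assumes "R \<subseteq> carrier (free_group X)"
    and "t \<in> carrier (free_group X)" "v \<in> carrier (free_group X)"
    and "conjugates_by X R t u v"
  shows "conjugates_by X R (reduce (inv_word t)) v u"
proof -
  interpret hom: group_hom "free_group X" "presented_group X R" "word_class X R"
    using assms(1) by (rule group_hom_word_class)
  have "reduce (inv_word t) = inv\<^bsub>free_group X\<^esub> t"
    using assms(2) by (simp add: inv_free_group)
  moreover have "inv\<^bsub>presented_group X R\<^esub> x \<otimes>\<^bsub>presented_group X R\<^esub> (x \<otimes>\<^bsub>presented_group X R\<^esub> y) = y"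
    if "x \<in> carrier (presented_group X R)" "y \<in> carrier (presented_group X R)" for x y
    using that by (simp add: hom.H.m_assoc[symmetric])
  ultimately show ?thesis
    using assms by (simp add: conjugates_by_def hom.H.m_assoc)
qed

section \<open>Short conjugators to cyclically reduced words\<close>

lemma length_reduce_le: "length (reduce w) \<le> length w"
proof (induction w)
  case (Cons a w)
  have "length (cons_cancel a v) \<le> Suc (length v)" for v
    by (cases v) auto
  then have "length (reduce (a # w)) \<le> Suc (length (reduce w))"
    by (simp add: reduce_def)
  with Cons show ?case by simp
qed (simp add: reduce_def)

lemma length_inv_word [simp]: "length (inv_word w) = length w"
  by (simp add: inv_word_def)

text \<open>Mutually inverse outer letters are stripped one pair at a time. Each pair shortens the
  word by two and lengthens the conjugator by at most one.\<close>

lemma ex_cyclically_reduced_conjugate: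
  assumes "R \<subseteq> carrier (free_group X)" and "u \<in> carrier (free_group X)"
  shows "\<exists>w\<in>carrier (free_group X). \<exists>s\<in>carrier (free_group X).
    cyclically_reduced w \<and> length w \<le> length u \<and> length s \<le> length u \<and> conjugates_by X R s u w"
  using assms(2)
proof (induction u rule: length_induct)
  case (1 u)
  note u = "1.prems"
  interpret hom: group_hom "free_group X" "presented_group X R" "word_class X R"
    using assms(1) by (rule group_hom_word_class)
  show ?case
  proof (cases "cyclically_reduced u")
    case True
    have Nil: "[] = \<one>\<^bsub>free_group X\<^esub>" by (simp add: free_group_def)
    have "[] \<in> carrier (free_group X)" "conjugates_by X R [] u u"
      unfolding conjugates_by_def Nil using u by simp_all
    with True u show ?thesis by (intro bexI[of _ u] bexI[of _ "[]"]) auto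
  next
    case False
    \<comment> \<open>The word has at least two letters, because no letter is its own
      inverse.\<close>
    with u obtain a m where m: "u = a # m @ [inv_letter a]"
      by (cases u; cases "tl u" rule: rev_cases) (auto simp: cyclically_reduced_def free_group_def)
    have carrier: "[a] \<in> carrier (free_group X)" "m \<in> carrier (free_group X)"
      using u unfolding m
      by (auto simp: free_group_def reduced_append dest: reduced_ConsD)
    have "length m < length u" by (simp add: m)
    then obtain w s where ws: "w \<in> carrier (free_group X)" "s \<in> carrier (free_group X)" "cyclically_reduced w"
      "length w \<le> length m" "length s \<le> length m" "conjugates_by X R s m w"
      using "1.IH"[rule_format, OF _ carrier(2)] by blast
    have "u = reduce u"
      using u by (simp add: free_group_def reduce_reduced)
    also have "\<dots> = [a] \<otimes>\<^bsub>free_group X\<^esub> m \<otimes>\<^bsub>free_group X\<^esub> inv\<^bsub>free_group X\<^esub> [a]"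
      unfolding inv_free_group[OF carrier(1)] m
      by (simp add: free_group_def reduce_append_left reduce_reduced inv_word_def)
    finally have "conjugates_by X R [a] u m"
      unfolding conjugates_by_def using carrier by (elim ssubst[of u]) simp
    then have "conjugates_by X R (reduce ([a] @ s)) u w"
      using assms(1) carrier ws by (intro conjugates_by_mult)
    moreover have "reduce ([a] @ s) \<in> carrier (free_group X)"
      using hom.G.m_closed[OF carrier(1) ws(2)] by (simp add: free_group_def)
    moreover have "length (reduce ([a] @ s)) \<le> length u"
      using length_reduce_le[of "[a] @ s"] ws(5) by (simp add: m)
    ultimately show ?thesis
      using ws by (intro bexI[of _ w] bexI[of _ "reduce ([a] @ s)"]) (auto simp: m)
  qed
qed

section \<open>Minimal conjugator lengths and their maximum\<close>

lemma ex_conjugates_by_conj_length: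
  assumes "conjugate_in X R u v"
  shows "\<exists>t\<in>carrier (free_group X). length t = conj_length X R u v \<and> conjugates_by X R t u v"
  unfolding conj_length_def
  by (rule LeastI_ex) (use assms in \<open>auto simp: conjugate_in_iff\<close>)

lemma conj_length_le_iff:
  assumes "conjugate_in X R u v"
  shows "conj_length X R u v \<le> n \<longleftrightarrow>
    (\<exists>t\<in>carrier (free_group X). length t \<le> n \<and> conjugates_by X R t u v)"
proof
  assume "\<exists>t\<in>carrier (free_group X). length t \<le> n \<and> conjugates_by X R t u v"
  then obtain t where "t \<in> carrier (free_group X)" "length t \<le> n" "conjugates_by X R t u v"
    by blast
  moreover from this have "conj_length X R u v \<le> length t"
    unfolding conj_length_def by (intro Least_le) blast
  ultimately show "conj_length X R u v \<le> n" by simp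
qed (use ex_conjugates_by_conj_length[OF assms] in metis)

text \<open>The maximum ranges over a finite set, as \<open>X\<close> is finite, and a nonempty one,
  as the pair of empty words qualifies.\<close>

lemma conj_length_bound_le_iff:
  assumes "finite X" and "R \<subseteq> carrier (free_group X)"
  shows "conj_length_bound X R n\<^sub>1 n\<^sub>2 \<le> n \<longleftrightarrow>
    (\<forall>u\<in>carrier (free_group X). \<forall>v\<in>carrier (free_group X).
      cyclically_reduced u \<and> cyclically_reduced v \<and> conjugate_in X R u v \<and>
      length u \<le> n\<^sub>1 \<and> length v \<le> n\<^sub>2 \<longrightarrow> conj_length X R u v \<le> n)"
  unfolding conj_length_bound_def
  by (subst Max_le_iff[OF finite_conj_lengths[OF assms(1)] conj_lengths_nonempty[OF assms(2)]]) blast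

text \<open>A conjugator is routed from \<open>u\<close> through cyclically reduced conjugates
  \<open>u'\<close> and \<open>v'\<close> to \<open>v\<close>. As these are no longer than
  \<open>u\<close> and \<open>v\<close>, the bound \<open>n\<close> applies to the middle
  stretch.\<close>

lemma conjugate_in_iff_bounded:
  assumes "finite X" and R: "R \<subseteq> carrier (free_group X)"
    and uv: "u \<in> carrier (free_group X)" "v \<in> carrier (free_group X)"
    and n: "conj_length_bound X R (length u) (length v) \<le> n"
  shows "conjugate_in X R u v \<longleftrightarrow>
    (\<exists>t\<in>carrier (free_group X). length t \<le> length u + n + length v \<and> conjugates_by X R t u v)"
proof
  assume "conjugate_in X R u v"
  then obtain r where r: "r \<in> carrier (free_group X)" "conjugates_by X R r u v"
    by (auto simp: conjugate_in_iff)
  have mult_closed: "reduce (a @ b) \<in> carrier (free_group X)"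
    if "a \<in> carrier (free_group X)" "b \<in> carrier (free_group X)" for a b
    using monoid.m_closed[OF group.is_monoid[OF group_free_group] that] by (simp add: free_group_def)
  obtain u' s where u': "u' \<in> carrier (free_group X)" "s \<in> carrier (free_group X)" "cyclically_reduced u'"
    "length u' \<le> length u" "length s \<le> length u" "conjugates_by X R s u u'"
    using ex_cyclically_reduced_conjugate[OF R uv(1)] by blast
  obtain v' p where v': "v' \<in> carrier (free_group X)" "p \<in> carrier (free_group X)" "cyclically_reduced v'"
    "length v' \<le> length v" "length p \<le> length v" "conjugates_by X R p v v'"
    using ex_cyclically_reduced_conjugate[OF R uv(2)] by blast
  note closed = r(1) uv u'(1,2) v'(1,2) inv_word_carrier mult_closed
  \<comment> \<open>The chain \<open>u'\<close>, \<open>u\<close>, \<open>v\<close>,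
    \<open>v'\<close> has the conjugator \<open>s^-1 r p\<close>, whose length is irrelevant
    here.\<close>
  have "conjugates_by X R (reduce (reduce (inv_word s) @ reduce (r @ p))) u' v'"
    by (intro conjugates_by_mult[OF R, where v = u] conjugates_by_mult[OF R, where v = v]
        conjugates_by_inv_word[OF R] closed r u' v')
  then have "conjugate_in X R u' v'"
    unfolding conjugate_in_iff by (rule bexI) (intro closed)
  with u' v' n have "conj_length X R u' v' \<le> n"
    using conj_length_bound_le_iff[OF assms(1) R] by blast
  then obtain t where t: "t \<in> carrier (free_group X)" "length t \<le> n" "conjugates_by X R t u' v'"
    using \<open>conjugate_in X R u' v'\<close> by (auto simp: conj_length_le_iff)
  \<comment> \<open>Now \<open>r\<close> is replaced by the short \<open>t\<close>, and the three
    lengths add up to the bound.\<close>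
  let ?t = "reduce (s @ reduce (t @ reduce (inv_word p)))"
  have "conjugates_by X R ?t u v"
    by (intro conjugates_by_mult[OF R, where v = u'] conjugates_by_mult[OF R, where v = v']
        conjugates_by_inv_word[OF R] closed u' v' t)
  moreover have "?t \<in> carrier (free_group X)"
    by (intro closed t)
  moreover have "length ?t \<le> length u + n + length v"
    using length_reduce_le[of "s @ t @ inv_word p"] u'(5) v'(5) t(2)
    by (simp add: reduce_append_right)
  ultimately show "\<exists>t\<in>carrier (free_group X). length t \<le> length u + n + length v \<and> conjugates_by X R t u v"
    by blast
qed (auto simp: conjugate_in_iff)


section \<open>The word problem and the conjugacy problem\<close>

text \<open>One call to the word problem suffices. The argument is freely reduced first, since the
  program is only guaranteed to halt on codes of reduced words.\<close>

lemma decidable_conjugates_by: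
  assumes X: "finite X" and R: "R \<subseteq> carrier (free_group X)" and "solvable_word_problem X R"
    and "computable T" and "computable U" and "computable V"
  shows "decidable (\<lambda>e. conjugates_by X R (word_decode X (T e)) (word_decode X (U e)) (word_decode X (V e)))"
proof -
  obtain r where r: "\<And>w. w \<in> carrier (free_group X) \<Longrightarrow>
      rec_eval r [word_code X w] (of_bool (trivial_in X R w))"
    using assms(3) unfolding solvable_word_problem_def of_bool_def by blast
  define w where "w e = word_decode X (T e) @ word_decode X (V e) @
      inv_word (word_decode X (T e)) @ inv_word (word_decode X (U e))" for e
  have letters: "set (word_decode X c) \<subseteq> X \<times> UNIV" "set (inv_word (word_decode X c)) \<subseteq> X \<times> UNIV" for c
    using word_decode_carrier[of X c] by (auto simp: free_group_def inv_word_def inv_letter_def)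
  then have set_w: "set (w e) \<subseteq> X \<times> UNIV" for e
    by (simp add: w_def)
  show ?thesis
    unfolding conjugates_by_iff_trivial_in[OF R word_decode_carrier word_decode_carrier word_decode_carrier]
  proof (fold w_def, rule computable_oracle1)
    show "rec_eval r [word_code X (reduce (w e))] (of_bool (trivial_in X R (reduce (w e))))" for e
      using set_w[of e] set_reduce[of "w e"] by (intro r) (auto simp: free_group_def reduced_reduce)
    have inv: "map (letter_code X) (inv_word v) = rev (map code_inv (map (letter_code X) v))" for v
      by (simp add: inv_word_def rev_map letter_code_inv_letter)
    show "computable (\<lambda>e. word_code X (reduce (w e)))"
      unfolding word_code_def map_letter_code_reduce[OF X set_w] unfolding w_def map_append inv
      by (intro computable_code_reduce computable_append computable_rev_map computable_code_inv
          computable_var computable_letter_codes assms)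
  qed
qed

lemma solvable_conjugacy_problem_if_bounded:
  assumes X: "finite X" and R: "R \<subseteq> carrier (free_group X)" and wp: "solvable_word_problem X R"
    and f: "computable2 f" and bound: "\<And>n\<^sub>1 n\<^sub>2. conj_length_bound X R n\<^sub>1 n\<^sub>2 \<le> f n\<^sub>1 n\<^sub>2"
  shows "solvable_conjugacy_problem X R"
proof -
  define N where "N a b = length (word_decode X a) + f (length (word_decode X a)) (length (word_decode X b)) +
      length (word_decode X b)" for a b
  \<comment> \<open>Thanks to \<open>word_decode\<close>, \<open>d\<close> is total on numbers; it
    has to agree with conjugacy on genuine codes only.\<close>
  define d :: "nat \<Rightarrow> nat \<Rightarrow> nat" where "d a b = of_bool (\<exists>c\<le>list_code_bound (2 * card X) (N a b).
      length (word_decode X c) \<le> N a b \<and> conjugates_by X R (word_decode X c) (word_decode X a) (word_decode X b))"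
    for a b
  have N: "computable (\<lambda>e. N (e i) (e j))" for i j
    unfolding N_def
    by (intro computable_add computable_if_computable2[OF f] computable_length_word_decode[OF X] computable_var)
  have "computable2 d"
    unfolding d_def
    by (intro computable2_if_computable decidable_ex_le decidable_conj decidable_le
        decidable_conjugates_by[OF X R wp] computable_list_code_bound computable_length_word_decode[OF X]
        N computable_var)
  moreover have "d (word_code X u) (word_code X v) = (if conjugate_in X R u v then 1 else 0)"
    if "u \<in> carrier (free_group X)" "v \<in> carrier (free_group X)" for u v
    unfolding conjugate_in_iff_bounded[OF X R that bound] ex_word_iff_ex_code[OF X] d_def N_def
      word_decode_word_code[OF X that(1)] word_decode_word_code[OF X that(2)]
    by (simp only: of_bool_def)
  ultimately show ?thesis
    unfolding computable2_def solvable_conjugacy_problem_def by metis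
qed

text \<open>Only the unit is conjugate to the unit, so the conjugacy program is run with the empty
  word as second input.\<close>

lemma solvable_word_problem_if_solvable_conjugacy_problem:
  assumes R: "R \<subseteq> carrier (free_group X)" and "solvable_conjugacy_problem X R"
  shows "solvable_word_problem X R"
proof -
  interpret hom: group_hom "free_group X" "presented_group X R" "word_class X R"
    using R by (rule group_hom_word_class)
  obtain r where r: "\<And>u v. u \<in> carrier (free_group X) \<Longrightarrow> v \<in> carrier (free_group X) \<Longrightarrow>
      rec_eval r [word_code X u, word_code X v] (if conjugate_in X R u v then 1 else 0)"
    using assms(2) unfolding solvable_conjugacy_problem_def by blast
  have Nil: "[] = \<one>\<^bsub>free_group X\<^esub>" by (simp add: free_group_def)
  have "rec_eval (Comp r [Proj 0, Zero]) [word_code X u] (if trivial_in X R u then 1 else 0)"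
    if u: "u \<in> carrier (free_group X)" for u
  proof (rule rec_eval.Comp)
    \<comment> \<open>\<open>Zero\<close> supplies the code 0 of the empty word.\<close>
    show "list_all2 (\<lambda>g. rec_eval g [word_code X u]) [Proj 0, Zero] [word_code X u, word_code X []]"
      using rec_eval.Proj[of 0 "[word_code X u]"] by (simp add: word_code_def rec_eval.Zero)
    have "conjugate_in X R u [] \<longleftrightarrow> trivial_in X R u"
      unfolding conjugate_in_def trivial_in_def Nil by auto
    then show "rec_eval r [word_code X u, word_code X []] (if trivial_in X R u then 1 else 0)"
      using r[OF u, of "[]"] by (simp add: Nil)
  qed
  then show ?thesis unfolding solvable_word_problem_def by blast
qed

lemma decidable_conjugate_in:
  assumes "solvable_conjugacy_problem X R" and "finite X" and "computable F" and "computable G"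
  shows "decidable (\<lambda>e. conjugate_in X R (word_decode X (F e)) (word_decode X (G e)))"
proof -
  obtain r where "\<And>u v. u \<in> carrier (free_group X) \<Longrightarrow> v \<in> carrier (free_group X) \<Longrightarrow>
      rec_eval r [word_code X u, word_code X v] (of_bool (conjugate_in X R u v))"
    using assms(1) unfolding solvable_conjugacy_problem_def of_bool_def by blast
  then show ?thesis
    by (rule computable_oracle2)
      (intro word_decode_carrier computable_word_code_word_decode assms)+
qed

lemma computable2_conj_length_bound:
  assumes X: "finite X" and R: "R \<subseteq> carrier (free_group X)" and cp: "solvable_conjugacy_problem X R"
  shows "computable2 (conj_length_bound X R)"
proof -
  let ?B = "list_code_bound (2 * card X)" and ?w = "word_decode X"
  \<comment> \<open>\<open>Q\<close> expresses that \<open>n\<close> bounds the maximum, with all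
    quantifiers over words turned into bounded quantifiers over codes.\<close>
  define Q where "Q n\<^sub>1 n\<^sub>2 n \<longleftrightarrow> (\<forall>a\<le>?B n\<^sub>1. length (?w a) \<le> n\<^sub>1 \<longrightarrow> (\<forall>b\<le>?B n\<^sub>2. length (?w b) \<le> n\<^sub>2 \<longrightarrow>
      cyclically_reduced (?w a) \<and> cyclically_reduced (?w b) \<and> conjugate_in X R (?w a) (?w b) \<longrightarrow>
      (\<exists>c\<le>?B n. length (?w c) \<le> n \<and> conjugates_by X R (?w c) (?w a) (?w b))))" for n\<^sub>1 n\<^sub>2 n
  have Q: "Q n\<^sub>1 n\<^sub>2 n \<longleftrightarrow> conj_length_bound X R n\<^sub>1 n\<^sub>2 \<le> n" for n\<^sub>1 n\<^sub>2 n
  proof -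
    have "conj_length_bound X R n\<^sub>1 n\<^sub>2 \<le> n \<longleftrightarrow>
      (\<forall>u\<in>carrier (free_group X). length u \<le> n\<^sub>1 \<longrightarrow> (\<forall>v\<in>carrier (free_group X). length v \<le> n\<^sub>2 \<longrightarrow>
        cyclically_reduced u \<and> cyclically_reduced v \<and> conjugate_in X R u v \<longrightarrow>
        (\<exists>t\<in>carrier (free_group X). length t \<le> n \<and> conjugates_by X R t u v)))"
      unfolding conj_length_bound_le_iff[OF X R] using conj_length_le_iff[of X R] by blast
    also have "\<dots> \<longleftrightarrow> Q n\<^sub>1 n\<^sub>2 n"
      unfolding all_word_iff_all_code[OF X] ex_word_iff_ex_code[OF X] Q_def by (rule refl)
    finally show ?thesis by (rule sym)
  qed
  have wp: "solvable_word_problem X R"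
    using R cp by (rule solvable_word_problem_if_solvable_conjugacy_problem)
  have "computable (\<lambda>e. LEAST n. Q (e 0) (e 1) n)"
  proof (rule computable_Least)
    \<comment> \<open>The candidate \<open>n\<close> is variable 0, so the two arguments move to
      positions 1 and 2.\<close>
    show "decidable (\<lambda>e. Q (e (Suc 0)) (e (Suc 1)) (e 0))"
      unfolding Q_def
      by (intro decidable_all_le decidable_ex_le decidable_imp decidable_conj decidable_le
          decidable_cyclically_reduced[OF X] decidable_conjugate_in[OF cp X]
          decidable_conjugates_by[OF X R wp] computable_list_code_bound
          computable_length_word_decode[OF X] computable_var)
    show "\<exists>n. Q (e 0) (e 1) n" for e :: "nat \<Rightarrow> nat"
      unfolding Q by blast
  qed
  moreover have "(LEAST n. Q n\<^sub>1 n\<^sub>2 n) = conj_length_bound X R n\<^sub>1 n\<^sub>2" for n\<^sub>1 n\<^sub>2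
    unfolding Q by (rule Least_equality) auto
  ultimately show ?thesis
    by (intro computable2_if_computable) simp
qed

theorem proposition1p5p1:
  fixes X :: "'a set" and R :: "'a gword set"
  assumes "finite X" and "R \<subseteq> carrier (free_group X)"
  shows "(solvable_conjugacy_problem X R \<longleftrightarrow>
            solvable_word_problem X R \<and>
            (\<exists>f. computable2 f \<and> (\<forall>n\<^sub>1 n\<^sub>2. conj_length_bound X R n\<^sub>1 n\<^sub>2 \<le> f n\<^sub>1 n\<^sub>2)))
         \<and> (solvable_conjugacy_problem X R \<longrightarrow> computable2 (conj_length_bound X R))"
  \<comment> \<open>In the forward direction the computable bound is
    \<open>conj_length_bound X R\<close> itself.\<close>
  using solvable_conjugacy_problem_if_bounded[OF assms] computable2_conj_length_bound[OF assms]
    solvable_word_problem_if_solvable_conjugacy_problem[OF assms(2)]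
  by blast

end
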